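(* Let $Y$ be a log-concave random variable on $\mathbb{Z}$ with mean $\mu=\mathbb{E}[Y]$, and let $n\in\mathbb{Z}$. Then $$2\operatorname{Var}[Y]\le\left(\frac{1}{\mathbb{P}^2(Y=n)}-1\right)+(\mu-n)^2,$$ with equality if and only if $Y$ is a discrete asymmetric Laplace random variable with mode $n$.
   Context: A function $f:\mathbb{R}\to[0,\infty)$ is log-concave if $f((1-s)x+sy)\ge f(x)^{1-s}f(y)^s$ for all $x,y\in\mathbb{R}$, $s\in[0,1]$. An integer-valued random variable $Y$ is log-concave on $\mathbb{Z}$ if its probability mass function is the restriction to $\mathbb{Z}$ of a log-concave function. Here $\mathbb{P}^2(Y=n)=(\mathbb{P}(Y=n))^2$, and $1/\mathbb{P}^2(Y=n)=+\infty$ if $\mathbb{P}(Y=n)=0$. For $p,q\in[0,1)$, the mode-centered discrete asymmetric Laplace distribution is the probability mass function on $\mathbb{Z}$ $$g_{p,q}(k)=C_{p,q}\begin{cases}p^{|k|}&k\le 0\\ q^{k}&k\ge 0\end{cases},\qquad C_{p,q}=\frac{(1-p)(1-q)}{1-pq},$$ with the convention $0^0=1$; the case $p=q=0$ is the point mass at $0$. A random variable is discrete asymmetric Laplace with mode $m\in\mathbb{Z}$ if its probability mass function is $k\mapsto g_{p,q}(k-m)$ for some $p,q\in[0,1)$. *)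

theory Defs
  imports "HOL-Probability.Probability"
begin

text \<open>Here \<open>0 powr 0 = 0\<close> rather than 1. This is harmless: the convention only matters for
  \<open>s = 0\<close>, \<open>f y = 0\<close> or \<open>s = 1\<close>, \<open>f x = 0\<close>, where the inequality holds with either value.\<close>

definition log_concave :: "(real \<Rightarrow> real) \<Rightarrow> bool" where
  "log_concave f \<longleftrightarrow> (\<forall>x. 0 \<le> f x) \<and>
     (\<forall>x y. \<forall>s\<in>{0..1}. f x powr (1 - s) * f y powr s \<le> f ((1 - s) * x + s * y))"

definition mass_fun :: "'a measure \<Rightarrow> ('a \<Rightarrow> int) \<Rightarrow> int \<Rightarrow> real" where
  "mass_fun M Y k = measure M {\<omega> \<in> space M. Y \<omega> = k}"

definition log_concave_on_ints :: "'a measure \<Rightarrow> ('a \<Rightarrow> int) \<Rightarrow> bool" where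
  "log_concave_on_ints M Y \<longleftrightarrow>
     (\<exists>f. log_concave f \<and> (\<forall>k::int. mass_fun M Y k = f (of_int k)))"

definition asym_laplace :: "real \<Rightarrow> real \<Rightarrow> int \<Rightarrow> real" where
  "asym_laplace p q k =
     (1 - p) * (1 - q) / (1 - p * q) * (if k \<le> 0 then p ^ nat \<bar>k\<bar> else q ^ nat k)"

definition asym_laplace_with_mode :: "'a measure \<Rightarrow> ('a \<Rightarrow> int) \<Rightarrow> int \<Rightarrow> bool" where
  "asym_laplace_with_mode M Y m \<longleftrightarrow>
     (\<exists>p\<in>{0..<1}. \<exists>q\<in>{0..<1}. \<forall>k. mass_fun M Y k = asym_laplace p q (k - m))"

end

theory Submission
  imports Defs
begin

text \<open>Suppose \<open>a = P(Y = n) > 0\<close>; when this probability vanishes the right-hand side is infinite and no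
asymmetric Laplace law has mode \<open>n\<close>. Cut the law of \<open>Y\<close> at \<open>n\<close>: the sequences \<open>P(Y = n + k) / a\<close> and
\<open>P(Y = n - k) / a\<close>, for \<open>k \<ge> 0\<close>, are log-concave and start at \<open>1\<close>. Let \<open>R\<close> and \<open>L\<close> be their sums
over \<open>k \<ge> 1\<close>, so that \<open>1 / a = T\<close> with \<open>T = 1 + R + L\<close>. If \<open>Mr, Ml\<close> and \<open>Vr, Vl\<close> are their first and
second moments, multiplying the claim by \<open>T\<^sup>2\<close> turns it into
\<open>2 T (Vr + Vl) \<le> T\<^sup>4 - T\<^sup>2 + 3 (Mr - Ml)\<^sup>2\<close> (lemma \<open>variance_gap\<close>).

Each side obeys two bounds, both instances of one fact: for a log-concave sequence the ratio of the
tail sum to the term is largest at the start (\<open>tail_sum_le\<close>), and tail sums are again log-concave.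
Used once this gives \<open>Mr \<le> R (1 + R)\<close>, with equality only for geometric sequences; used twice it gives
\<open>R (Vr + Mr) \<le> 2 Mr\<^sup>2\<close>. Writing \<open>Mr = R (1 + u)\<close>, where \<open>u \<ge> 0\<close> since
\<open>Mr \<ge> R\<close>, the bounds read \<open>u \<le> R\<close> and \<open>Vr \<le> R (1 + u) (1 + 2 u)\<close> (\<open>moments_log_concave_seq\<close>), and likewise on the left with \<open>L\<close> and \<open>w\<close>.

What remains is a polynomial inequality (\<open>deficit_nonneg\<close>). After the second moments are replaced by
their bounds, the difference of the two sides is a concave quadratic in \<open>u\<close> and in \<open>w\<close>, because the
term \<open>3 (Mr - Ml)\<^sup>2\<close> is outweighed by the second moments. It is therefore minimal at a corner of the box
\<open>[0, R] \<times> [0, L]\<close>; it vanishes at \<open>(R, L)\<close> and is positive at the other corners unless the box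
degenerates. Equality thus forces \<open>u = R\<close> and \<open>w = L\<close>, that is, geometric decay on both sides of \<open>n\<close>.\<close>

section \<open>Log-concave sequences and their tail sums\<close>

text \<open>The four-point form of log-concavity on the nonnegative integers. Unlike the comparison of
  \<open>a (k + 1)\<^sup>2\<close> with \<open>a k * a (k + 2)\<close>, it also rules out gaps in the support.\<close>
definition log_concave_seq :: "(nat \<Rightarrow> real) \<Rightarrow> bool" where
  "log_concave_seq a \<longleftrightarrow>
     (\<forall>k. 0 \<le> a k) \<and> (\<forall>i j m. i \<le> j \<longrightarrow> a i * a (j + m) \<le> a (i + m) * a j)"

definition tail_sum :: "(nat \<Rightarrow> real) \<Rightarrow> nat \<Rightarrow> real" where
  "tail_sum a k = (\<Sum>j. a (j + k))"

lemma log_concave_seqD: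
  assumes "log_concave_seq a"
  shows "0 \<le> a k" and "i \<le> j \<Longrightarrow> a i * a (j + m) \<le> a (i + m) * a j"
  using assms by (auto simp: log_concave_seq_def)

lemma log_concave_seq_scale:
  assumes "log_concave_seq a" "0 \<le> c"
  shows "log_concave_seq (\<lambda>k. c * a k)"
proof -
  have "c * a i * (c * a (j + m)) \<le> c * a (i + m) * (c * a j)" if "i \<le> j" for i j m
    using mult_left_mono[OF log_concave_seqD(2)[OF assms(1) that, of m], of "c * c"]
    by (simp add: ac_simps)
  then show ?thesis using assms by (simp add: log_concave_seq_def)
qed

text \<open>The inner points \<open>i + m\<close> and \<open>j\<close> are the convex combinations of \<open>i\<close> and \<open>j + m\<close> with exchanged
  weights, so in the product of the two inequalities the exponents of each factor add up to \<open>1\<close>.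
  An affine argument covers both half-lines starting at an integer.\<close>
lemma log_concave_seq_of_log_concave:
  assumes "log_concave f"
  shows "log_concave_seq (\<lambda>k. f (c + d * real k))"
proof -
  have nn: "0 \<le> f x" for x using assms by (auto simp: log_concave_def)
  have lc: "f x powr (1 - s) * f y powr s \<le> f ((1 - s) * x + s * y)" if "0 \<le> s" "s \<le> 1" for x y s
    using assms that by (auto simp: log_concave_def)
  have "f (c + d * real i) * f (c + d * real (j + m)) \<le> f (c + d * real (i + m)) * f (c + d * real j)"
    if ij: "i \<le> j" for i j m
  proof (cases "j + m = i")
    case True
    then have "m = 0" "i = j" using ij by auto
    then show ?thesis by simp
  next
    case False
    \<comment> \<open>\<open>l\<close> is the distance between the two outer points.\<close>
    define l where "l = real j - real i + real m"
    define s where "s = real m / l"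
    have l: "0 < l" using False ij by (simp add: l_def)
    have s: "0 \<le> s" "s \<le> 1" using l ij by (auto simp: s_def l_def)
    have sl: "s * l = real m" using l by (simp add: s_def)
    let ?x = "c + d * real i" and ?y = "c + d * real (j + m)"
    have e1: "(1 - s) * ?x + s * ?y = c + d * real (i + m)"
    proof -
      have "(1 - s) * ?x + s * ?y = c + d * (real i + s * l)"
        by (simp add: l_def algebra_simps)
      then show ?thesis by (simp add: sl)
    qed
    have e2: "(1 - (1 - s)) * ?x + (1 - s) * ?y = c + d * real j"
    proof -
      have "(1 - (1 - s)) * ?x + (1 - s) * ?y = c + d * (real j + real m - s * l)"
        by (simp add: l_def algebra_simps)
      then show ?thesis by (simp add: sl)
    qed
    have "f ?x * f ?y = (f ?x powr (1 - s) * f ?x powr s) * (f ?y powr s * f ?y powr (1 - s))"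
      using nn by (simp add: powr_add [symmetric])
    also have "\<dots> = (f ?x powr (1 - s) * f ?y powr s) * (f ?x powr (1 - (1 - s)) * f ?y powr (1 - s))"
      by simp
    also have "\<dots> \<le> f (c + d * real (i + m)) * f (c + d * real j)"
      using lc[of s ?x ?y] lc[of "1 - s" ?x ?y] s nn unfolding e1 e2 by (intro mult_mono) auto
    finally show ?thesis .
  qed
  then show ?thesis using nn by (auto simp: log_concave_seq_def)
qed

lemma tail_sum_split:
  assumes "summable a"
  shows "tail_sum a k = (\<Sum>l<m. a (k + l)) + tail_sum a (k + m)"
proof -
  have "summable (\<lambda>j. a (j + k))" using assms by (simp add: summable_iff_shift)
  from suminf_split_initial_segment[OF this, of m]
  show ?thesis by (simp add: tail_sum_def add.commute add.left_commute)
qed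

lemma tail_sum_Suc: "summable a \<Longrightarrow> tail_sum a k = a k + tail_sum a (Suc k)"
  using tail_sum_split[of a k 1] by simp

text \<open>Splitting off the first \<open>m\<close> terms of the tails at \<open>i\<close> and at \<open>j\<close> cancels the product of the two
  remaining tails; what is left is a sum of four-point inequalities for \<open>a\<close>, one for each pair of terms.\<close>
lemma log_concave_seq_tail_sum:
  assumes a: "log_concave_seq a" and s: "summable a"
  shows "log_concave_seq (tail_sum a)"
proof -
  have sk: "summable (\<lambda>j. a (j + k))" for k using s by (simp add: summable_iff_shift)
  have "tail_sum a i * tail_sum a (j + m) \<le> tail_sum a (i + m) * tail_sum a j" if ij: "i \<le> j" for i j m
  proof -
    have "(\<Sum>l<m. a (i + l)) * tail_sum a (j + m) = (\<Sum>l<m. a (i + l) * tail_sum a (j + m))"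
      by (simp add: sum_distrib_right)
    also have "\<dots> \<le> (\<Sum>l<m. tail_sum a (i + m) * a (j + l))"
    proof (rule sum_mono)
      fix l assume l: "l \<in> {..<m}"
      have "a (i + l) * a (r + (j + m)) \<le> a (r + (i + m)) * a (j + l)" for r
        using log_concave_seqD(2)[OF a, of "i + l" "j + l" "m + r - l"] ij l
        by (simp add: algebra_simps)
      then have "(\<Sum>r. a (i + l) * a (r + (j + m))) \<le> (\<Sum>r. a (r + (i + m)) * a (j + l))"
        by (intro suminf_le summable_mult summable_mult2 sk)
      then show "a (i + l) * tail_sum a (j + m) \<le> tail_sum a (i + m) * a (j + l)"
        unfolding tail_sum_def suminf_mult[OF sk] suminf_mult2[OF sk] .
    qed
    also have "\<dots> = tail_sum a (i + m) * (\<Sum>l<m. a (j + l))"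
      by (simp add: sum_distrib_left)
    finally show ?thesis
      using tail_sum_split[OF s, of i m] tail_sum_split[OF s, of j m] by (simp add: algebra_simps)
  qed
  moreover have "0 \<le> tail_sum a k" for k
    using log_concave_seqD(1)[OF a] by (auto simp: tail_sum_def intro!: suminf_nonneg sk)
  ultimately show ?thesis by (auto simp: log_concave_seq_def)
qed

text \<open>The ratio of the tail sum to the term does not exceed its initial value. This is the source of
  both upper bounds on the moments below.\<close>
lemma tail_sum_le:
  assumes a: "log_concave_seq a" and s: "summable a"
  shows "tail_sum a k * a 0 \<le> tail_sum a 0 * a k"
proof -
  have sk: "summable (\<lambda>j. a (j + k))" for k using s by (simp add: summable_iff_shift)
  have "a (j + k) * a 0 \<le> a j * a k" for j
    using log_concave_seqD(2)[OF a, of 0 k j] by (simp add: algebra_simps)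
  then have "(\<Sum>j. a (j + k) * a 0) \<le> (\<Sum>j. a j * a k)"
    by (intro suminf_le summable_mult2 sk s)
  then show ?thesis by (simp add: tail_sum_def suminf_mult2 [symmetric] sk s)
qed

text \<open>The tail sums are dominated by a multiple of the sequence itself. Applied repeatedly, this yields
  that the moments are finite.\<close>
lemma summable_tail_sum:
  assumes a: "log_concave_seq a" and s: "summable a" and a0: "0 < a 0"
  shows "summable (tail_sum a)"
proof (rule summable_comparison_test')
  show "summable (\<lambda>k. tail_sum a 0 / a 0 * a k)" using s by (rule summable_mult)
  show "norm (tail_sum a k) \<le> tail_sum a 0 / a 0 * a k" for k
    using tail_sum_le[OF a s, of k] a0 log_concave_seqD(1)[OF log_concave_seq_tail_sum[OF a s], of k]
    by (simp add: field_simps)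
qed

text \<open>Abel summation, in the direction that produces moments from iterated tail sums: weights \<open>1\<close> on
  the tail sums give the first moment, weights \<open>k\<close> give the moment of \<open>k (k - 1) / 2\<close>.\<close>
lemma sums_weighted_tail_sum:
  fixes w b :: "nat \<Rightarrow> real"
  assumes b: "\<And>k. 0 \<le> b k" and w: "\<And>k. 0 \<le> w k"
    and s: "summable b" and st: "summable (\<lambda>k. w k * tail_sum b (Suc k))"
  shows "(\<lambda>k. (\<Sum>i<k. w i) * b k) sums (\<Sum>k. w k * tail_sum b (Suc k))"
proof -
  define W where "W k = (\<Sum>i<k. w i)" for k
  have sk: "summable (\<lambda>j. b (j + k))" for k using s by (simp add: summable_iff_shift)
  have tn: "0 \<le> tail_sum b k" for k by (auto simp: tail_sum_def intro!: suminf_nonneg sk b)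
  have Wn: "0 \<le> W k" for k by (auto simp: W_def intro!: sum_nonneg w)
  have Wm: "W k \<le> W l" if "k \<le> l" for k l
    unfolding W_def using that w by (intro sum_mono2) auto
  have abel: "(\<Sum>k<N. w k * tail_sum b (Suc k)) = (\<Sum>k<N. W k * b k) + W N * tail_sum b N" for N
  proof (induction N)
    case 0
    then show ?case by (simp add: W_def)
  next
    case (Suc N)
    then show ?case using tail_sum_Suc[OF s, of N] by (simp add: W_def algebra_simps)
  qed
  have sW: "summable (\<lambda>k. W k * b k)"
  proof (rule summableI_nonneg_bounded)
    show "0 \<le> W n * b n" for n using Wn b by simp
    show "(\<Sum>k<n. W k * b k) \<le> (\<Sum>k. w k * tail_sum b (Suc k))" for n
    proof -
      have "(\<Sum>k<n. W k * b k) \<le> (\<Sum>k<n. w k * tail_sum b (Suc k))"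
        using abel[of n] Wn[of n] tn[of n] by simp
      also have "\<dots> \<le> (\<Sum>k. w k * tail_sum b (Suc k))"
        using w tn by (intro sum_le_suminf st) auto
      finally show ?thesis .
    qed
  qed
  \<comment> \<open>The boundary term is at most the remainder of the convergent series of \<open>W k * b k\<close>.\<close>
  have "(\<lambda>N. W N * tail_sum b N) \<longlonglongrightarrow> 0"
  proof (rule tendsto_sandwich)
    show "\<forall>\<^sub>F N in sequentially. 0 \<le> W N * tail_sum b N" using Wn tn by simp
    show "\<forall>\<^sub>F N in sequentially. W N * tail_sum b N \<le> (\<Sum>j. W (j + N) * b (j + N))"
    proof (rule always_eventually, rule allI)
      fix N
      have "W N * tail_sum b N = (\<Sum>j. W N * b (j + N))"
        unfolding tail_sum_def suminf_mult[OF sk] ..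
      also have "\<dots> \<le> (\<Sum>j. W (j + N) * b (j + N))"
        by (intro suminf_le summable_mult sk mult_right_mono Wm b
            summable_ignore_initial_segment[OF sW]) auto
      finally show "W N * tail_sum b N \<le> (\<Sum>j. W (j + N) * b (j + N))" .
    qed
    show "(\<lambda>N. \<Sum>j. W (j + N) * b (j + N)) \<longlonglongrightarrow> 0"
      using suminf_exist_split2[OF sW] by simp
  qed simp
  moreover have "(\<lambda>N. \<Sum>k<N. w k * tail_sum b (Suc k)) \<longlonglongrightarrow> (\<Sum>k. w k * tail_sum b (Suc k))"
    using summable_LIMSEQ[OF st] .
  ultimately have "(\<lambda>N. (\<Sum>k<N. w k * tail_sum b (Suc k)) - W N * tail_sum b N)
      \<longlonglongrightarrow> (\<Sum>k. w k * tail_sum b (Suc k)) - 0"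
    by (intro tendsto_diff)
  then show ?thesis by (simp add: abel sums_def W_def)
qed

section \<open>Moments of one-sided sequences\<close>
lemma square_eq_sum_below: "(real k)\<^sup>2 = 2 * (\<Sum>i<k. real i) + real k"
  by (induction k) (simp_all add: power2_eq_square algebra_simps)

text \<open>In terms of the sum \<open>R\<close> of the terms after the first, these are the extremal values in
  \<open>moments_log_concave_seq\<close>, attained at \<open>u = R\<close>.\<close>
lemma moments_geometric:
  fixes q :: real
  assumes q: "0 \<le> q" "q < 1"
  defines "R \<equiv> q / (1 - q)"
  shows "(\<lambda>k. q ^ k) sums (1 + R)"
    and "(\<lambda>k. real k * q ^ k) sums (R * (1 + R))"
    and "(\<lambda>k. (real k)\<^sup>2 * q ^ k) sums (R * (1 + R) * (1 + 2 * R))"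
proof -
  have R1: "1 + R = 1 / (1 - q)" using q by (simp add: R_def field_simps)
  show s0: "(\<lambda>k. q ^ k) sums (1 + R)"
    using geometric_sums[of q] q by (simp add: R1)
  have t: "tail_sum (\<lambda>k. q ^ k) (Suc k) = R * q ^ k" for k
  proof -
    have "tail_sum (\<lambda>k. q ^ k) (Suc k) = (\<Sum>j. q ^ j * q ^ Suc k)"
      by (simp only: tail_sum_def power_add)
    also have "\<dots> = (1 + R) * q ^ Suc k"
      using sums_mult2[OF s0] by (rule sums_unique[symmetric])
    also have "\<dots> = R * q ^ k" unfolding R1 by (simp add: R_def)
    finally show ?thesis .
  qed
  note s = sums_summable[OF s0]
  have "(\<lambda>k. (\<Sum>i<k. 1) * q ^ k) sums (\<Sum>k. 1 * tail_sum (\<lambda>k. q ^ k) (Suc k))"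
    using q s by (intro sums_weighted_tail_sum) (simp_all add: t summable_mult)
  then show s1: "(\<lambda>k. real k * q ^ k) sums (R * (1 + R))"
    by (simp add: t suminf_mult[OF s] sums_unique[OF s0, symmetric])
  have "(\<lambda>k. (\<Sum>i<k. real i) * q ^ k) sums (\<Sum>k. real k * tail_sum (\<lambda>k. q ^ k) (Suc k))"
    using q summable_mult[OF sums_summable[OF s1], of R]
    by (intro sums_weighted_tail_sum s) (simp_all add: t ac_simps)
  also have "(\<Sum>k. real k * tail_sum (\<lambda>k. q ^ k) (Suc k)) = R * (R * (1 + R))"
    using sums_unique[OF sums_mult[OF s1, of R]] by (simp add: t ac_simps)
  finally have s2: "(\<lambda>k. (\<Sum>i<k. real i) * q ^ k) sums (R * (R * (1 + R)))" .
  have "(\<lambda>k. 2 * ((\<Sum>i<k. real i) * q ^ k) + real k * q ^ k)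
      sums (2 * (R * (R * (1 + R))) + R * (1 + R))"
    by (intro sums_add sums_mult s1 s2)
  moreover have "2 * ((\<Sum>i<k. real i) * q ^ k) + real k * q ^ k = (real k)\<^sup>2 * q ^ k" for k
    by (simp add: square_eq_sum_below algebra_simps)
  ultimately show "(\<lambda>k. (real k)\<^sup>2 * q ^ k) sums (R * (1 + R) * (1 + 2 * R))"
    by (simp add: algebra_simps)
qed

text \<open>Let \<open>B k\<close> be the sum of the terms after the \<open>k\<close>-th and let \<open>m\<close> be the first moment, which is the
  sum of \<open>B\<close>. Comparing tails with terms for \<open>b\<close> gives \<open>B k \<le> R * b k\<close>, whence \<open>m \<le> R (1 + R)\<close>; equality
  makes every one of these comparisons an equality, which is the recursion of a geometric sequence. The
  same comparison for the log-concave sequence \<open>B\<close>, whose initial term is \<open>R\<close> and whose sum is \<open>m\<close>,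
  bounds the sum of its tail sums by \<open>m\<^sup>2 / R\<close>; that sum is half of \<open>V + m\<close>. The parameter \<open>u\<close> is defined
  by \<open>m = R (1 + u)\<close>; then both bounds are polynomial and make sense for \<open>R = 0\<close> as well.\<close>
lemma moments_log_concave_seq:
  fixes b :: "nat \<Rightarrow> real"
  assumes lc: "log_concave_seq b" and s: "summable b" and b0: "b 0 = 1"
  defines "R \<equiv> (\<Sum>k. b (Suc k))"
  obtains u V where "0 \<le> u" "u \<le> R"
    and "(\<lambda>k. real k * b k) sums (R * (1 + u))"
    and "(\<lambda>k. (real k)\<^sup>2 * b k) sums V"
    and "V \<le> R * (1 + u) * (1 + 2 * u)"
    and "u = R \<longrightarrow> (\<forall>k. b k = (R / (1 + R)) ^ k)"
proof -
  define B where "B k = tail_sum b (Suc k)" for k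
  have bn: "0 \<le> b k" for k using log_concave_seqD(1)[OF lc] .
  have lct: "log_concave_seq (tail_sum b)" using lc s by (rule log_concave_seq_tail_sum)
  have lcB: "log_concave_seq B"
    unfolding log_concave_seq_def B_def
    using log_concave_seqD(1)[OF lct] log_concave_seqD(2)[OF lct, of "Suc i" "Suc j" for i j] by simp
  have Bn: "0 \<le> B k" for k using log_concave_seqD(1)[OF lcB] .
  have R: "R = B 0" by (simp add: R_def B_def tail_sum_def)
  then have Rn: "0 \<le> R" using Bn by simp
  have sb: "(\<Sum>k. b k) = 1 + R"
    using suminf_split_head[OF s] by (simp add: R_def b0)
  have sB: "summable B"
    unfolding B_def using summable_tail_sum[OF lc s] b0 by (simp add: summable_Suc_iff)
  have B_le: "B k \<le> R * b k" for k
  proof -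
    have "tail_sum b 0 = 1 + R" by (simp add: tail_sum_def sb)
    then have "b k + B k \<le> (1 + R) * b k"
      using tail_sum_le[OF lc s, of k] tail_sum_Suc[OF s, of k] by (simp add: B_def b0)
    then show ?thesis by (simp add: algebra_simps)
  qed
  define m where "m = (\<Sum>k. B k)"
  have "(\<lambda>k. (\<Sum>i<k. 1) * b k) sums (\<Sum>k. 1 * tail_sum b (Suc k))"
    using bn s sB[unfolded B_def [abs_def]] by (intro sums_weighted_tail_sum) simp_all
  then have sm: "(\<lambda>k. real k * b k) sums m"
    by (simp add: m_def B_def)
  have Rm: "R \<le> m"
    unfolding m_def R using sum_le_suminf[OF sB, of "{0}"] Bn by simp
  have mR: "m \<le> R * (1 + R)"
    unfolding m_def sb[symmetric] suminf_mult[OF s, symmetric]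
    by (intro suminf_le B_le sB summable_mult s)
  have geo: "\<forall>k. b k = (R / (1 + R)) ^ k" if "m = R * (1 + R)"
  proof -
    have "(\<lambda>k. R * b k - B k) sums (R * (1 + R) - m)"
      unfolding m_def sb[symmetric] by (intro sums_diff sums_mult summable_sums s sB)
    then have "(\<lambda>k. R * b k - B k) sums 0" by (simp add: that)
    then have "B k = R * b k" for k
      using suminf_eq_zero_iff[of "\<lambda>k. R * b k - B k"] B_le
      by (auto simp: sums_iff)
    then have "b (Suc k) * (1 + R) = R * b k" for k
      using tail_sum_Suc[OF s, of "Suc k"] by (simp add: B_def algebra_simps)
    then have "b (Suc k) = R / (1 + R) * b k" for k
      using Rn by (simp add: field_simps)
    then have "b k = (R / (1 + R)) ^ k" for k
      by (induction k) (simp_all add: b0)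
    then show ?thesis by simp
  qed
  \<comment> \<open>If \<open>R = 0\<close>, only the initial term survives, and \<open>u\<close> has to be \<open>0\<close>.\<close>
  show thesis
  proof (cases "R = 0")
    case True
    then have "B k = 0" for k using B_le[of k] Bn[of k] by simp
    then have "b (Suc k) = 0" for k
      using tail_sum_Suc[OF s, of "Suc k"] by (simp add: B_def)
    then have z: "real k * b k = 0" for k by (cases k) auto
    have z2: "(real k)\<^sup>2 * b k = 0" for k using z[of k] by (simp add: power2_eq_square)
    have "m = R * (1 + R)" using mR Rm True by simp
    then show thesis
      using geo by (intro that[of 0 0]) (simp_all only: z z2 sums_zero, simp_all add: True)
  next
    case False
    then have Rp: "0 < R" using Rn by simp
    define u where "u = m / R - 1"
    have mu: "m = R * (1 + u)" using Rp by (simp add: u_def)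
    have sC: "summable (tail_sum B)"
      using summable_tail_sum[OF lcB sB] Rp by (simp add: R)
    have sC1: "summable (\<lambda>k. tail_sum B (Suc k))" using sC by (simp add: summable_Suc_iff)
    have C0: "tail_sum B 0 = m" by (simp add: tail_sum_def m_def)
    \<comment> \<open>\<open>c\<close> turns out to be the moment of \<open>k (k - 1) / 2\<close>, so that \<open>V = 2 * c + m\<close>.\<close>
    define c where "c = (\<Sum>k. tail_sum B (Suc k))"
    have sumC: "(\<Sum>k. tail_sum B k) = m + c"
      using suminf_split_head[OF sC] by (simp add: c_def C0)
    have "(\<Sum>k. tail_sum B k * R) \<le> (\<Sum>k. m * B k)"
      using tail_sum_le[OF lcB sB] by (intro suminf_le summable_mult summable_mult2 sB sC) (simp add: R C0)
    then have c_le: "(m + c) * R \<le> m * m"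
      by (simp add: suminf_mult[OF sB] suminf_mult2[OF sC, symmetric] sumC m_def[symmetric])
    have "(\<lambda>k. (\<Sum>i<k. 1) * B k) sums (\<Sum>k. 1 * tail_sum B (Suc k))"
      using Bn sB sC1 by (intro sums_weighted_tail_sum) simp_all
    then have skB: "(\<lambda>k. real k * B k) sums c" by (simp add: c_def)
    have "(\<lambda>k. (\<Sum>i<k. real i) * b k) sums (\<Sum>k. real k * tail_sum b (Suc k))"
      using bn s sums_summable[OF skB] by (intro sums_weighted_tail_sum) (simp_all add: B_def)
    then have "(\<lambda>k. (\<Sum>i<k. real i) * b k) sums c"
      using sums_unique[OF skB] by (simp add: B_def)
    then have "(\<lambda>k. 2 * ((\<Sum>i<k. real i) * b k) + real k * b k) sums (2 * c + m)"
      by (intro sums_add sums_mult sm)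
    then have sV: "(\<lambda>k. (real k)\<^sup>2 * b k) sums (2 * c + m)"
      by (simp add: square_eq_sum_below algebra_simps)
    have "R * (2 * c + m) \<le> R * (R * (1 + u) * (1 + 2 * u))"
      using c_le unfolding mu by (simp add: algebra_simps)
    then have V_le: "2 * c + m \<le> R * (1 + u) * (1 + 2 * u)" using Rp by simp
    show thesis
      using sm sV V_le Rm mR Rp geo by (intro that[of u "2 * c + m"]) (auto simp: mu)
  qed
qed

section \<open>The polynomial inequality\<close>
text \<open>The difference between the right-hand and the left-hand side of the inequality to be proved,
  multiplied by \<open>T\<^sup>2\<close> with \<open>T = 1 + R + L\<close>, when the first moments are \<open>R (1 + u)\<close> and \<open>L (1 + w)\<close> and the
  second moments take their largest values.\<close>
definition deficit :: "real \<Rightarrow> real \<Rightarrow> real \<Rightarrow> real \<Rightarrow> real" where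
  "deficit R L u w = (1 + R + L) ^ 4 - (1 + R + L)\<^sup>2 + 3 * (R * (1 + u) - L * (1 + w))\<^sup>2
     - 2 * (1 + R + L) * (R * (1 + u) * (1 + 2 * u) + L * (1 + w) * (1 + 2 * w))"

lemma deficit_swap: "deficit R L u w = deficit L R w u"
  by (simp add: deficit_def algebra_simps power2_eq_square)

lemma deficit_corner_00:
  "deficit R L 0 0 = (R + L) ^ 4 + 4 * (R + L) ^ 3 + 3 * (R + L)\<^sup>2 + 3 * (R - L)\<^sup>2"
  unfolding deficit_def by algebra

lemma deficit_corner_0L:
  "deficit R L 0 L = R\<^sup>2 * (6 * (1 + L)\<^sup>2 + 4 * (1 + L) * R + R\<^sup>2)"
  unfolding deficit_def by algebra

lemma deficit_corner_RL: "deficit R L R L = 0"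
  unfolding deficit_def by algebra

text \<open>The coefficient of \<open>u\<^sup>2\<close> is \<open>- R (4 + R + 4 L)\<close>, so the quadratic lies above its chord over
  \<open>[0, R]\<close>. The inequality is multiplied by \<open>R\<close> in order to cover \<open>R = 0\<close>.\<close>
lemma deficit_concave:
  assumes "0 \<le> u" "u \<le> R" "0 \<le> L"
  shows "(R - u) * deficit R L 0 w + u * deficit R L R w \<le> R * deficit R L u w"
proof -
  have "R * deficit R L u w - ((R - u) * deficit R L 0 w + u * deficit R L R w)
      = R * (u * (R - u)) * (R * (4 + R + 4 * L))"
    unfolding deficit_def by algebra
  moreover have "0 \<le> R * (u * (R - u)) * (R * (4 + R + 4 * L))"
    using assms by (intro mult_nonneg_nonneg) auto
  ultimately show ?thesis by linarith
qed

text \<open>On this edge of the box, concavity in \<open>w\<close> reduces the claim to the two corners.\<close>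
lemma deficit_pos_at_0:
  assumes "0 < R" "0 \<le> w" "w \<le> L"
  shows "0 < deficit R L 0 w"
proof -
  have L: "0 \<le> L" using assms by simp
  have c00: "0 < deficit R L 0 0"
    unfolding deficit_corner_00 using assms L by (intro add_pos_nonneg) auto
  have c0L: "0 < deficit R L 0 L"
    unfolding deficit_corner_0L using assms L
    by (intro mult_pos_pos add_pos_nonneg) auto
  show ?thesis
  proof (cases "L = 0")
    case True
    then show ?thesis using c00 assms by simp
  next
    case False
    have "(L - w) * deficit R L 0 0 + w * deficit R L 0 L \<le> L * deficit R L 0 w"
      using deficit_concave[of w L R 0] assms by (simp add: deficit_swap[of R L])
    moreover have "0 < (L - w) * deficit R L 0 0 + w * deficit R L 0 L"
    proof (cases "w = 0")
      case True
      then show ?thesis using c00 L False by simp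
    next
      case False
      then show ?thesis using c00 c0L assms by (intro add_nonneg_pos) auto
    qed
    ultimately have "0 < L * deficit R L 0 w" by linarith
    then show ?thesis using L by (simp add: zero_less_mult_iff)
  qed
qed

text \<open>This edge ends in the corner at which the deficit vanishes. By symmetry its other end is a corner
  of the kind treated in \<open>deficit_pos_at_0\<close>.\<close>
lemma deficit_at_R:
  assumes "0 \<le> R" "0 \<le> w" "w \<le> L"
  shows "0 \<le> deficit R L R w" and "deficit R L R w = 0 \<Longrightarrow> w = L"
proof -
  have "0 < deficit R L R w" if "w < L"
  proof -
    have "0 < (L - w) * deficit L R 0 R"
      using that assms by (intro mult_pos_pos deficit_pos_at_0) auto
    also have "\<dots> \<le> L * deficit R L R w"
      using deficit_concave[of w L R R] assms by (simp add: deficit_swap[of R L] deficit_corner_RL)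
    finally show ?thesis using that assms by (simp add: zero_less_mult_iff)
  qed
  then show "0 \<le> deficit R L R w" and "deficit R L R w = 0 \<Longrightarrow> w = L"
    using assms deficit_corner_RL[of R L] by (cases "w = L"; force)+
qed

text \<open>Concavity in \<open>u\<close> between the two edges.\<close>
lemma deficit_nonneg:
  assumes "0 \<le> u" "u \<le> R" "0 \<le> w" "w \<le> L"
  shows "0 \<le> deficit R L u w" and "deficit R L u w = 0 \<Longrightarrow> u = R \<and> w = L"
proof -
  have R: "0 \<le> R" using assms by simp
  have "0 < deficit R L u w" if "u < R"
  proof -
    have "0 < (R - u) * deficit R L 0 w"
      using that assms by (intro mult_pos_pos deficit_pos_at_0) auto
    also have "\<dots> \<le> (R - u) * deficit R L 0 w + u * deficit R L R w"
      using deficit_at_R(1)[OF R assms(3,4)] assms(1) by simp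
    also have "\<dots> \<le> R * deficit R L u w"
      using assms by (intro deficit_concave) auto
    finally show ?thesis using R by (simp add: zero_less_mult_iff)
  qed
  then show "0 \<le> deficit R L u w" and "deficit R L u w = 0 \<Longrightarrow> u = R \<and> w = L"
    using assms deficit_at_R[OF R assms(3,4)] by (cases "u = R"; force)+
qed

section \<open>Moments of integer-valued random variables\<close>
text \<open>Termwise integration: the integrand is a series of multiples of the indicators of the disjoint
  events \<open>Z = k\<close>, of which at most one is nonzero at any point.\<close>
lemma (in prob_space) has_bochner_integral_nonneg_part:
  fixes Z :: "'a \<Rightarrow> int" and h :: "nat \<Rightarrow> real"
  assumes Z [measurable]: "Z \<in> measurable M (count_space UNIV)"
    and s: "summable (\<lambda>k. \<bar>h k\<bar> * mass_fun M Z (int k))"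
  shows "has_bochner_integral M (\<lambda>\<omega>. if 0 \<le> Z \<omega> then h (nat (Z \<omega>)) else 0)
           (\<Sum>k. h k * mass_fun M Z (int k))"
proof -
  define A where "A k = {\<omega> \<in> space M. Z \<omega> = int k}" for k
  have A [measurable]: "A k \<in> sets M" for k unfolding A_def by measurable
  define f where "f k \<omega> = h k * indicator (A k) \<omega>" for k \<omega>
  have fi: "integrable M (f k)" for k
    unfolding f_def by (intro integrable_mult_right integrable_real_indicator) (auto simp: emeasure_eq_measure)
  have If: "(\<integral>\<omega>. f k \<omega> \<partial>M) = h k * mass_fun M Z (int k)" for k
    by (simp add: f_def mass_fun_def A_def)
  have In: "(\<integral>\<omega>. norm (f k \<omega>) \<partial>M) = \<bar>h k\<bar> * mass_fun M Z (int k)" for k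
    by (simp add: f_def abs_mult mass_fun_def A_def)
  have f: "f k \<omega> = (if k = nat (Z \<omega>) \<and> 0 \<le> Z \<omega> then h k else 0)" if "\<omega> \<in> space M" for k \<omega>
    using that by (auto simp: f_def A_def indicator_def)
  have fs: "summable (\<lambda>k. norm (f k \<omega>))" if "\<omega> \<in> space M" for \<omega>
    using that by (intro summable_finite[of "{nat (Z \<omega>)}"]) (auto simp: f)
  have S: "(\<Sum>k. f k \<omega>) = (if 0 \<le> Z \<omega> then h (nat (Z \<omega>)) else 0)" if "\<omega> \<in> space M" for \<omega>
    using that by (subst suminf_finite[of "{nat (Z \<omega>)}"]) (auto simp: f)
  have ae: "AE \<omega> in M. summable (\<lambda>k. norm (f k \<omega>))" using fs by (intro AE_I2)
  have sn: "summable (\<lambda>k. \<integral>\<omega>. norm (f k \<omega>) \<partial>M)" unfolding In by (rule s)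
  note integrable_suminf[OF fi ae sn] integral_suminf[OF fi ae sn]
  then have "has_bochner_integral M (\<lambda>\<omega>. \<Sum>k. f k \<omega>) (\<Sum>k. h k * mass_fun M Z (int k))"
    by (simp add: has_bochner_integral_iff If)
  then show ?thesis
    by (rule has_bochner_integral_cong[THEN iffD1, rotated -1]) (simp_all add: S)
qed

text \<open>The left half is indexed from \<open>n - 1\<close> downwards, so that it is disjoint from the right half, which
  starts at \<open>n\<close>.\<close>
lemma (in prob_space) has_bochner_integral_two_sided:
  fixes Y :: "'a \<Rightarrow> int" and F :: "int \<Rightarrow> real"
  assumes Y [measurable]: "Y \<in> measurable M (count_space UNIV)"
    and s: "summable (\<lambda>k. \<bar>F (int k)\<bar> * mass_fun M Y (n + int k))"
      "summable (\<lambda>k. \<bar>F (- int (Suc k))\<bar> * mass_fun M Y (n - int (Suc k)))"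
  shows "has_bochner_integral M (\<lambda>\<omega>. F (Y \<omega> - n))
           ((\<Sum>k. F (int k) * mass_fun M Y (n + int k)) +
            (\<Sum>k. F (- int (Suc k)) * mass_fun M Y (n - int (Suc k))))"
proof -
  have r: "mass_fun M (\<lambda>\<omega>. Y \<omega> - n) (int k) = mass_fun M Y (n + int k)" for k
    unfolding mass_fun_def by (rule arg_cong[of _ _ "measure M"]) auto
  have l: "mass_fun M (\<lambda>\<omega>. n - Y \<omega> - 1) (int k) = mass_fun M Y (n - int (Suc k))" for k
    unfolding mass_fun_def by (rule arg_cong[of _ _ "measure M"]) auto
  have "has_bochner_integral M
      (\<lambda>\<omega>. (if 0 \<le> Y \<omega> - n then F (int (nat (Y \<omega> - n))) else 0) +
        (if 0 \<le> n - Y \<omega> - 1 then F (- int (Suc (nat (n - Y \<omega> - 1)))) else 0))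
      ((\<Sum>k. F (int k) * mass_fun M (\<lambda>\<omega>. Y \<omega> - n) (int k)) +
       (\<Sum>k. F (- int (Suc k)) * mass_fun M (\<lambda>\<omega>. n - Y \<omega> - 1) (int k)))"
    using s by (intro has_bochner_integral_add has_bochner_integral_nonneg_part) (simp_all add: r l)
  then show ?thesis
    unfolding r l
    by (rule has_bochner_integral_cong[THEN iffD1, rotated -1]) auto
qed

lemma (in prob_space) summable_mass_fun:
  fixes Y :: "'a \<Rightarrow> int"
  assumes Y [measurable]: "Y \<in> measurable M (count_space UNIV)" and c: "inj c"
  shows "summable (\<lambda>k. mass_fun M Y (c k))"
proof -
  have "(\<lambda>k. prob {\<omega> \<in> space M. Y \<omega> = c k}) sums prob (\<Union>k. {\<omega> \<in> space M. Y \<omega> = c k})"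
    using c by (intro finite_measure_UNION) (auto simp: disjoint_family_on_def inj_def)
  then show ?thesis by (simp add: mass_fun_def sums_iff)
qed

text \<open>Both series start at \<open>k = 0\<close>, so the value \<open>n\<close> is counted twice; the last term corrects this and
  is nonzero only for \<open>i = 0\<close>.\<close>
lemma (in prob_space) has_bochner_integral_power:
  fixes Y :: "'a \<Rightarrow> int"
  assumes Y: "Y \<in> measurable M (count_space UNIV)"
    and x: "(\<lambda>k. real k ^ i * mass_fun M Y (n + int k)) sums x"
    and y: "(\<lambda>k. real k ^ i * mass_fun M Y (n - int k)) sums y"
  shows "has_bochner_integral M (\<lambda>\<omega>. real_of_int (Y \<omega> - n) ^ i)
           (x + (- 1) ^ i * y - 0 ^ i * mass_fun M Y n)"
proof -
  define F where "F k = real_of_int k ^ i" for k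
  have Fneg: "F (- int k) = (- 1) ^ i * real k ^ i" for k
    by (simp add: F_def power_minus[of "real k"])
  have mn: "0 \<le> mass_fun M Y k" for k by (simp add: mass_fun_def)
  have "(\<lambda>k. (- 1) ^ i * (real k ^ i * mass_fun M Y (n - int k))) sums ((- 1) ^ i * y)"
    using y by (rule sums_mult)
  then have "(\<lambda>k. F (- int k) * mass_fun M Y (n - int k)) sums ((- 1) ^ i * y)"
    by (simp add: Fneg ac_simps)
  then have l: "(\<lambda>k. F (- int (Suc k)) * mass_fun M Y (n - int (Suc k)))
      sums ((- 1) ^ i * y - 0 ^ i * mass_fun M Y n)"
    by (subst sums_Suc_iff) (simp add: F_def)
  have r: "(\<lambda>k. F (int k) * mass_fun M Y (n + int k)) sums x"
    using x by (simp add: F_def)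
  have "summable (\<lambda>k. \<bar>F (int k)\<bar> * mass_fun M Y (n + int k))"
    using sums_summable[OF x] by (simp add: F_def power_abs)
  moreover have "summable (\<lambda>k. \<bar>F (- int (Suc k))\<bar> * mass_fun M Y (n - int (Suc k)))"
    using sums_summable[OF y, THEN summable_ignore_initial_segment, of 1]
    by (simp add: F_def power_abs add.commute)
  ultimately have "has_bochner_integral M (\<lambda>\<omega>. F (Y \<omega> - n))
      ((\<Sum>k. F (int k) * mass_fun M Y (n + int k)) +
       (\<Sum>k. F (- int (Suc k)) * mass_fun M Y (n - int (Suc k))))"
    by (rule has_bochner_integral_two_sided[OF Y])
  then show ?thesis
    unfolding sums_unique[OF l, symmetric] sums_unique[OF r, symmetric]
    by (simp add: F_def add_diff_eq)
qed

text \<open>The moments of order \<open>0\<close>, \<open>1\<close>, \<open>2\<close> of \<open>Y - n\<close> are \<open>1 = a T\<close>, \<open>a (Mr - Ml)\<close> and \<open>a (Vr + Vl)\<close>.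
  Multiplication by \<open>T\<^sup>2 = 1 / a\<^sup>2\<close> clears all denominators. The identity serves both
  the inequality and the evaluation of the gap for asymmetric Laplace laws.\<close>
lemma (in prob_space) variance_gap:
  fixes Y :: "'a \<Rightarrow> int"
  assumes Y: "Y \<in> measurable M (count_space UNIV)"
    and a: "a = mass_fun M Y n" "0 < a"
    and r: "(\<lambda>k. mass_fun M Y (n + int k)) sums (a * (1 + R))"
      "(\<lambda>k. real k * mass_fun M Y (n + int k)) sums (a * Mr)"
      "(\<lambda>k. (real k)\<^sup>2 * mass_fun M Y (n + int k)) sums (a * Vr)"
    and l: "(\<lambda>k. mass_fun M Y (n - int k)) sums (a * (1 + L))"
      "(\<lambda>k. real k * mass_fun M Y (n - int k)) sums (a * Ml)"
      "(\<lambda>k. (real k)\<^sup>2 * mass_fun M Y (n - int k)) sums (a * Vl)"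
  defines "T \<equiv> 1 + R + L"
  shows "a * T = 1"
    and "T\<^sup>2 * (1 / a\<^sup>2 - 1 + (expectation (\<lambda>\<omega>. real_of_int (Y \<omega>)) - real_of_int n)\<^sup>2
           - 2 * variance (\<lambda>\<omega>. real_of_int (Y \<omega>)))
         = T ^ 4 - T\<^sup>2 + 3 * (Mr - Ml)\<^sup>2 - 2 * T * (Vr + Vl)"
proof -
  define X where "X \<omega> = real_of_int (Y \<omega> - n)" for \<omega>
  have "has_bochner_integral M (\<lambda>\<omega>. X \<omega> ^ 0) (a * (1 + R) + a * (1 + L) - a)"
    using has_bochner_integral_power[OF Y, of 0 n] r(1) l(1) a by (simp add: X_def)
  then show aT: "a * T = 1"
    by (simp add: has_bochner_integral_iff T_def algebra_simps prob_space)
  have "has_bochner_integral M (\<lambda>\<omega>. X \<omega> ^ 1) (a * Mr - a * Ml)"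
    using has_bochner_integral_power[OF Y, of 1 n] r(2) l(2) by (simp add: X_def)
  then have X1: "integrable M X" "expectation X = a * (Mr - Ml)"
    by (simp_all add: has_bochner_integral_iff algebra_simps)
  have "has_bochner_integral M (\<lambda>\<omega>. X \<omega> ^ 2) (a * Vr + a * Vl)"
    using has_bochner_integral_power[OF Y, of 2 n] r(3) l(3) by (simp add: X_def)
  then have X2: "integrable M (\<lambda>\<omega>. (X \<omega>)\<^sup>2)" "expectation (\<lambda>\<omega>. (X \<omega>)\<^sup>2) = a * (Vr + Vl)"
    by (simp_all add: has_bochner_integral_iff algebra_simps)
  have YX: "real_of_int (Y \<omega>) = X \<omega> + n" for \<omega> by (simp add: X_def)
  have EY: "expectation (\<lambda>\<omega>. real_of_int (Y \<omega>)) = a * (Mr - Ml) + n"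
    unfolding YX using X1 by (simp add: prob_space)
  have "variance (\<lambda>\<omega>. real_of_int (Y \<omega>)) = variance X"
    unfolding EY unfolding X1(2) YX by simp
  also have "\<dots> = a * (Vr + Vl) - (a * (Mr - Ml))\<^sup>2"
    using variance_eq[OF X1(1) X2(1)] unfolding X1(2) X2(2) .
  finally have var: "variance (\<lambda>\<omega>. real_of_int (Y \<omega>)) = a * (Vr + Vl) - (a * (Mr - Ml))\<^sup>2" .
  have "1 / a = T" using aT a(2) by (simp add: divide_eq_eq mult.commute)
  then have T: "1 / a\<^sup>2 = T\<^sup>2" by (simp add: power_one_over [symmetric])
  show "T\<^sup>2 * (1 / a\<^sup>2 - 1 + (expectation (\<lambda>\<omega>. real_of_int (Y \<omega>)) - real_of_int n)\<^sup>2
           - 2 * variance (\<lambda>\<omega>. real_of_int (Y \<omega>)))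
         = T ^ 4 - T\<^sup>2 + 3 * (Mr - Ml)\<^sup>2 - 2 * T * (Vr + Vl)"
    unfolding var unfolding EY T using aT by algebra
qed

section \<open>The inequality and its equality case\<close>
text \<open>The direction \<open>d\<close> is \<open>1\<close> for the half-line to the right of \<open>n\<close> and \<open>- 1\<close> for the one to the left.\<close>
lemma (in prob_space) one_sided_moments:
  fixes Y :: "'a \<Rightarrow> int"
  assumes Y: "Y \<in> measurable M (count_space UNIV)"
    and f: "log_concave f" "\<And>k::int. mass_fun M Y k = f (of_int k)"
    and a: "a = mass_fun M Y n" "0 < a" and d: "d \<noteq> 0"
  obtains R u V where "0 \<le> u" "u \<le> R"
    and "(\<lambda>k. mass_fun M Y (n + d * int k)) sums (a * (1 + R))"
    and "(\<lambda>k. real k * mass_fun M Y (n + d * int k)) sums (a * (R * (1 + u)))"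
    and "(\<lambda>k. (real k)\<^sup>2 * mass_fun M Y (n + d * int k)) sums (a * V)"
    and "V \<le> R * (1 + u) * (1 + 2 * u)"
    and "u = R \<longrightarrow> (\<forall>k. mass_fun M Y (n + d * int k) = a * (R / (1 + R)) ^ k)"
proof -
  define b where "b k = (1 / a) * mass_fun M Y (n + d * int k)" for k
  have mb: "mass_fun M Y (n + d * int k) = a * b k" for k using a by (simp add: b_def)
  have "log_concave_seq (\<lambda>k. (1 / a) * f (real_of_int n + real_of_int d * real k))"
    using a by (intro log_concave_seq_scale log_concave_seq_of_log_concave f) simp
  then have lc: "log_concave_seq b" by (simp add: b_def [abs_def] f(2))
  have s: "summable b"
    unfolding b_def using d by (intro summable_mult summable_mass_fun Y) (simp add: inj_def)
  have b0: "b 0 = 1" using a by (simp add: b_def)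
  define R where "R = (\<Sum>k. b (Suc k))"
  obtain u V
    where m: "0 \<le> u" "u \<le> R"
    "(\<lambda>k. real k * b k) sums (R * (1 + u))"
    "(\<lambda>k. (real k)\<^sup>2 * b k) sums V"
    "V \<le> R * (1 + u) * (1 + 2 * u)"
    "u = R \<longrightarrow> (\<forall>k. b k = (R / (1 + R)) ^ k)"
    by (rule moments_log_concave_seq[OF lc s b0, folded R_def]) (rule that; assumption)
  have "b sums (1 + R)"
    using suminf_split_head[OF s] s by (simp add: R_def b0 sums_iff)
  then show thesis
    using m sums_mult[of b "1 + R" a] sums_mult[OF m(3), of a] sums_mult[OF m(4), of a]
    by (intro that[of u R V]) (simp_all add: mb ac_simps)
qed

lemma asym_laplace_right: "asym_laplace p q (int k) = asym_laplace p q 0 * q ^ k"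
  by (simp add: asym_laplace_def)

lemma asym_laplace_left: "asym_laplace p q (- int k) = asym_laplace p q 0 * p ^ k"
  by (simp add: asym_laplace_def)

lemma asym_laplace_0_pos:
  assumes "p \<in> {0..<1}" "q \<in> {0..<1}"
  shows "0 < asym_laplace p q 0"
proof -
  have "p * q < 1" using mult_strict_mono'[of p 1 q 1] assms by simp
  then show ?thesis using assms by (simp add: asym_laplace_def)
qed

text \<open>The gap times \<open>T\<^sup>2\<close> is at least the deficit. If the gap vanishes, then so does the deficit, and both
  sides are geometric with ratios \<open>q = R / (1 + R)\<close> and \<open>p = L / (1 + L)\<close>; the normalising constant is the
  right one because \<open>a = 1 / T\<close>.\<close>
lemma (in prob_space) variance_gap_log_concave:
  fixes Y :: "'a \<Rightarrow> int" and n :: int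
  assumes Y: "Y \<in> measurable M (count_space UNIV)"
    and lc: "log_concave_on_ints M Y" and pos: "0 < mass_fun M Y n"
  defines "G \<equiv> 1 / (mass_fun M Y n)\<^sup>2 - 1
    + (expectation (\<lambda>\<omega>. real_of_int (Y \<omega>)) - real_of_int n)\<^sup>2
    - 2 * variance (\<lambda>\<omega>. real_of_int (Y \<omega>))"
  shows "0 \<le> G" and "G = 0 \<Longrightarrow> asym_laplace_with_mode M Y n"
proof -
  obtain f where f: "log_concave f" "\<And>k. mass_fun M Y k = f (of_int k)"
    using lc by (auto simp: log_concave_on_ints_def)
  define a where "a = mass_fun M Y n"
  have a: "0 < a" using pos by (simp add: a_def)
  obtain R u Vr where r: "0 \<le> u" "u \<le> R"
    "(\<lambda>k. mass_fun M Y (n + 1 * int k)) sums (a * (1 + R))"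
    "(\<lambda>k. real k * mass_fun M Y (n + 1 * int k)) sums (a * (R * (1 + u)))"
    "(\<lambda>k. (real k)\<^sup>2 * mass_fun M Y (n + 1 * int k)) sums (a * Vr)"
    "Vr \<le> R * (1 + u) * (1 + 2 * u)"
    "u = R \<longrightarrow> (\<forall>k. mass_fun M Y (n + 1 * int k) = a * (R / (1 + R)) ^ k)"
    by (rule one_sided_moments[OF Y f a_def a one_neq_zero]) (rule that; assumption)
  have minus1: "- 1 \<noteq> (0 :: int)" by simp
  obtain L w Vl where l: "0 \<le> w" "w \<le> L"
    "(\<lambda>k. mass_fun M Y (n + (- 1) * int k)) sums (a * (1 + L))"
    "(\<lambda>k. real k * mass_fun M Y (n + (- 1) * int k)) sums (a * (L * (1 + w)))"
    "(\<lambda>k. (real k)\<^sup>2 * mass_fun M Y (n + (- 1) * int k)) sums (a * Vl)"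
    "Vl \<le> L * (1 + w) * (1 + 2 * w)"
    "w = L \<longrightarrow> (\<forall>k. mass_fun M Y (n + (- 1) * int k) = a * (L / (1 + L)) ^ k)"
    by (rule one_sided_moments[OF Y f a_def a minus1]) (rule that; assumption)
  define T where "T = 1 + R + L"
  have T: "0 < T" using r l by (simp add: T_def)
  have g: "a * T = 1"
    "T\<^sup>2 * G = T ^ 4 - T\<^sup>2 + 3 * (R * (1 + u) - L * (1 + w))\<^sup>2 - 2 * T * (Vr + Vl)"
    unfolding G_def T_def a_def[symmetric]
    using variance_gap[OF Y a_def a, of R "R * (1 + u)" Vr L "L * (1 + w)" Vl] r l by simp_all
  have "T * (Vr + Vl) \<le> T * (R * (1 + u) * (1 + 2 * u) + L * (1 + w) * (1 + 2 * w))"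
    using T r l by (intro mult_left_mono) auto
  then have d: "deficit R L u w \<le> T\<^sup>2 * G"
    unfolding g deficit_def T_def[symmetric] by simp
  have "0 \<le> deficit R L u w" using r l by (intro deficit_nonneg)
  then have "0 \<le> T\<^sup>2 * G" using d by linarith
  then show "0 \<le> G" using T by (simp add: zero_le_mult_iff)
  assume "G = 0"
  then have "deficit R L u w = 0"
    using d \<open>0 \<le> deficit R L u w\<close> by simp
  then have "u = R" "w = L" using deficit_nonneg(2)[of u R w L] r l by auto
  define q p where "q = R / (1 + R)" and "p = L / (1 + L)"
  have mr: "mass_fun M Y (n + int k) = a * q ^ k"
    and ml: "mass_fun M Y (n - int k) = a * p ^ k" for k
    using r(7) l(7) \<open>u = R\<close> \<open>w = L\<close> by (simp_all add: q_def p_def)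
  have R0: "0 \<le> R" "0 \<le> L" using r l by auto
  have pq: "p \<in> {0..<1}" "q \<in> {0..<1}" using R0 by (auto simp: p_def q_def field_simps)
  have "(1 - p) * (1 - q) / (1 - p * q) = 1 / T"
  proof -
    have "1 + R \<noteq> 0" "1 + L \<noteq> 0" using R0 by auto
    then have "(1 - p) * (1 - q) = 1 / ((1 + R) * (1 + L))"
      and "1 - p * q = T / ((1 + R) * (1 + L))"
      unfolding p_def q_def T_def by (simp_all add: divide_simps) algebra
    then show ?thesis using R0 by (simp add: add_nonneg_eq_0_iff)
  qed
  also have "\<dots> = a" using g(1) T by (simp add: field_simps)
  finally have C: "asym_laplace p q 0 = a" by (simp add: asym_laplace_def)
  have "mass_fun M Y k = asym_laplace p q (k - n)" for k
  proof (cases "n \<le> k")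
    case True
    then show ?thesis
      using mr[of "nat (k - n)"] asym_laplace_right[of p q "nat (k - n)"] by (simp add: C)
  next
    case False
    then show ?thesis
      using ml[of "nat (n - k)"] asym_laplace_left[of p q "nat (n - k)"] by (simp add: C)
  qed
  then show "asym_laplace_with_mode M Y n"
    using pq unfolding asym_laplace_with_mode_def by blast
qed

text \<open>For geometric sequences the moment bounds are attained, so the gap times \<open>T\<^sup>2\<close> equals the deficit
  at the corner \<open>(R, L)\<close>.\<close>
lemma (in prob_space) variance_gap_asym_laplace:
  fixes Y :: "'a \<Rightarrow> int" and n :: int
  assumes Y: "Y \<in> measurable M (count_space UNIV)"
    and L: "asym_laplace_with_mode M Y n"
  shows "0 < mass_fun M Y n"
    and "1 / (mass_fun M Y n)\<^sup>2 - 1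
      + (expectation (\<lambda>\<omega>. real_of_int (Y \<omega>)) - real_of_int n)\<^sup>2
      - 2 * variance (\<lambda>\<omega>. real_of_int (Y \<omega>)) = 0"
proof -
  obtain p q where pq: "p \<in> {0..<1}" "q \<in> {0..<1}"
    and m: "\<And>k. mass_fun M Y k = asym_laplace p q (k - n)"
    using L by (auto simp: asym_laplace_with_mode_def)
  define a where "a = mass_fun M Y n"
  have C: "a = asym_laplace p q 0" by (simp add: a_def m)
  show pos: "0 < mass_fun M Y n" using asym_laplace_0_pos[OF pq] by (simp add: m)
  then have a: "0 < a" by (simp add: a_def)
  have mr: "mass_fun M Y (n + int k) = a * q ^ k"
    and ml: "mass_fun M Y (n - int k) = a * p ^ k" for k
    using asym_laplace_right[of p q k] asym_laplace_left[of p q k] by (simp_all add: m C)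
  define R L where "R = q / (1 - q)" and "L = p / (1 - p)"
  have R0: "0 \<le> R" "0 \<le> L" using pq by (auto simp: R_def L_def)
  have sr: "(\<lambda>k. q ^ k) sums (1 + R)" "(\<lambda>k. real k * q ^ k) sums (R * (1 + R))"
      "(\<lambda>k. (real k)\<^sup>2 * q ^ k) sums (R * (1 + R) * (1 + 2 * R))"
    using moments_geometric[of q] pq by (auto simp: R_def)
  have sl: "(\<lambda>k. p ^ k) sums (1 + L)" "(\<lambda>k. real k * p ^ k) sums (L * (1 + L))"
      "(\<lambda>k. (real k)\<^sup>2 * p ^ k) sums (L * (1 + L) * (1 + 2 * L))"
    using moments_geometric[of p] pq by (auto simp: L_def)
  have "(1 + R + L)\<^sup>2 * (1 / a\<^sup>2 - 1
      + (expectation (\<lambda>\<omega>. real_of_int (Y \<omega>)) - real_of_int n)\<^sup>2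
      - 2 * variance (\<lambda>\<omega>. real_of_int (Y \<omega>))) = deficit R L R L"
    unfolding deficit_def
    using sr[THEN sums_mult, of a] sl[THEN sums_mult, of a]
    by (intro variance_gap(2)[OF Y a_def a]) (simp_all add: mr ml ac_simps)
  then show "1 / (mass_fun M Y n)\<^sup>2 - 1
      + (expectation (\<lambda>\<omega>. real_of_int (Y \<omega>)) - real_of_int n)\<^sup>2
      - 2 * variance (\<lambda>\<omega>. real_of_int (Y \<omega>)) = 0"
    using R0 by (simp add: deficit_corner_RL a_def)
qed

theorem theorem1p3:
  fixes M :: "'a measure" and Y :: "'a \<Rightarrow> int" and \<mu> :: real and n :: int
  assumes "prob_space M"
    and "Y \<in> measurable M (count_space UNIV)"
    and "log_concave_on_ints M Y"
    and "\<mu> = prob_space.expectation M (\<lambda>\<omega>. real_of_int (Y \<omega>))"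
  shows "ereal (2 * prob_space.variance M (\<lambda>\<omega>. real_of_int (Y \<omega>)))
           \<le> (1 / (ereal (mass_fun M Y n))\<^sup>2 - 1) + ereal ((\<mu> - real_of_int n)\<^sup>2)
       \<and> (ereal (2 * prob_space.variance M (\<lambda>\<omega>. real_of_int (Y \<omega>)))
           = (1 / (ereal (mass_fun M Y n))\<^sup>2 - 1) + ereal ((\<mu> - real_of_int n)\<^sup>2)
         \<longleftrightarrow> asym_laplace_with_mode M Y n)"
proof -
  interpret prob_space M by fact
  define v where "v = variance (\<lambda>\<omega>. real_of_int (Y \<omega>))"
  show ?thesis
  proof (cases "mass_fun M Y n = 0")
    case True
    then have "1 / (ereal (mass_fun M Y n))\<^sup>2 - 1 + ereal ((\<mu> - real_of_int n)\<^sup>2) = \<infinity>"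
      by (simp add: power2_eq_square divide_ereal_def one_ereal_def)
    moreover have "\<not> asym_laplace_with_mode M Y n"
      using variance_gap_asym_laplace(1)[OF assms(2)] True by force
    ultimately show ?thesis by simp
  next
    case False
    define a where "a = mass_fun M Y n"
    have a: "0 < a" using False by (simp add: a_def mass_fun_def zero_less_measure_iff)
    define g where "g = 1 / a\<^sup>2 - 1 + (\<mu> - real_of_int n)\<^sup>2"
    have rhs: "1 / (ereal a)\<^sup>2 - 1 + ereal ((\<mu> - real_of_int n)\<^sup>2) = ereal g"
      using a by (simp add: g_def one_ereal_def)
    have pos: "0 < mass_fun M Y n" using a by (simp add: a_def)
    have le: "0 \<le> g - 2 * v"
      and eq_imp: "g - 2 * v = 0 \<Longrightarrow> asym_laplace_with_mode M Y n"
      using variance_gap_log_concave[OF assms(2,3) pos]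
      unfolding g_def a_def v_def assms(4) by blast+
    have imp_eq: "g - 2 * v = 0" if "asym_laplace_with_mode M Y n"
      using variance_gap_asym_laplace(2)[OF assms(2) that]
      unfolding g_def a_def v_def assms(4) .
    have "2 * v = g \<longleftrightarrow> asym_laplace_with_mode M Y n"
      using eq_imp imp_eq by (metis diff_eq_diff_eq diff_self)
    with le show ?thesis
      unfolding a_def[symmetric] v_def[symmetric] rhs by simp
  qed
qed

end
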